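(* Let $s\ge 1$ and let $(X,d)$ be a complete $b$-metric space with constant $s$ and with $|X|\ge 3$. Let $T:X\to X$ be a paired-Chatterjea contraction, i.e. there exists $\alpha\in\left[0,\frac{1}{2s}\right)$ such that $$d(Tx,Ty)+d(Ty,Tz)\le \alpha\bigl(d(x,Ty)+d(y,Tx)+d(y,Tz)+d(z,Ty)\bigr)$$ for all pairwise distinct $x,y,z\in X$. Then $T$ has a fixed point in $X$ if and only if $T$ has no periodic points of prime period $2$. Moreover, the number of fixed points of $T$ is at most two.
   Context: A $b$-metric with constant $s\ge 1$ on a nonempty set $X$ is a function $d:X\times X\to[0,\infty)$ such that for all $x,y,z\in X$: (a) $d(x,y)=0$ iff $x=y$; (b) $d(x,y)=d(y,x)$; (c) $d(x,z)\le s[d(x,y)+d(y,z)]$. A sequence $\{x_n\}$ converges to $x$ if $d(x_n,x)\to 0$; it is Cauchy if $d(x_n,x_m)\to 0$ as $n,m\to\infty$; $(X,d)$ is complete if every Cauchy sequence converges to a point of $X$. A fixed point of $T$ is a point $x$ with $Tx=x$. A periodic point of prime period $2$ is a point $y\in X$ with $T(Ty)=y$ and $Ty\ne y$. *)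

theory Defs
  imports Complex_Main "HOL-Library.FuncSet"
begin

text \<open>The carrier \<open>X\<close> is an explicit set; nothing is required of \<open>d\<close> outside of it.\<close>

locale b_metric_space =
  fixes X :: "'a set" and d :: "'a \<Rightarrow> 'a \<Rightarrow> real" and s :: real
  assumes nonempty: "X \<noteq> {}"
    and s_ge_1: "1 \<le> s"
    and nonneg: "\<lbrakk>x \<in> X; y \<in> X\<rbrakk> \<Longrightarrow> 0 \<le> d x y"
    and zero_iff: "\<lbrakk>x \<in> X; y \<in> X\<rbrakk> \<Longrightarrow> d x y = 0 \<longleftrightarrow> x = y"
    and commute: "\<lbrakk>x \<in> X; y \<in> X\<rbrakk> \<Longrightarrow> d x y = d y x"
    and relaxed_triangle:
      "\<lbrakk>x \<in> X; y \<in> X; z \<in> X\<rbrakk> \<Longrightarrow> d x z \<le> s * (d x y + d y z)"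

definition b_converges :: "('a \<Rightarrow> 'a \<Rightarrow> real) \<Rightarrow> (nat \<Rightarrow> 'a) \<Rightarrow> 'a \<Rightarrow> bool" where
  "b_converges d u l \<longleftrightarrow> (\<lambda>n. d (u n) l) \<longlonglongrightarrow> 0"

definition b_Cauchy :: "('a \<Rightarrow> 'a \<Rightarrow> real) \<Rightarrow> (nat \<Rightarrow> 'a) \<Rightarrow> bool" where
  "b_Cauchy d u \<longleftrightarrow> (\<forall>\<epsilon>>0. \<exists>N. \<forall>n\<ge>N. \<forall>m\<ge>N. \<bar>d (u n) (u m)\<bar> < \<epsilon>)"

definition b_complete :: "'a set \<Rightarrow> ('a \<Rightarrow> 'a \<Rightarrow> real) \<Rightarrow> bool" where
  "b_complete X d \<longleftrightarrow>
    (\<forall>u. (\<forall>n. u n \<in> X) \<and> b_Cauchy d u \<longrightarrow> (\<exists>l\<in>X. b_converges d u l))"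

definition paired_Chatterjea ::
  "'a set \<Rightarrow> ('a \<Rightarrow> 'a \<Rightarrow> real) \<Rightarrow> real \<Rightarrow> ('a \<Rightarrow> 'a) \<Rightarrow> bool" where
  "paired_Chatterjea X d s T \<longleftrightarrow>
    (\<exists>\<alpha>. 0 \<le> \<alpha> \<and> \<alpha> < 1 / (2 * s) \<and>
      (\<forall>x\<in>X. \<forall>y\<in>X. \<forall>z\<in>X. x \<noteq> y \<and> y \<noteq> z \<and> x \<noteq> z \<longrightarrow>
        d (T x) (T y) + d (T y) (T z)
          \<le> \<alpha> * (d x (T y) + d y (T x) + d y (T z) + d z (T y))))"

definition fixed_points :: "'a set \<Rightarrow> ('a \<Rightarrow> 'a) \<Rightarrow> 'a set" where
  "fixed_points X T = {x \<in> X. T x = x}"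

definition prime_period_2_points :: "'a set \<Rightarrow> ('a \<Rightarrow> 'a) \<Rightarrow> 'a set" where
  "prime_period_2_points X T = {y \<in> X. T (T y) = y \<and> T y \<noteq> y}"

end

theory Submission
  imports Defs
begin

text \<open>
  Evaluated on three pairwise distinct points that \<open>T\<close> merely permutes, with the middle one fixed
  and the outer two either fixed or swapped, the contraction inequality reads
  \<open>A \<le> 2 * \<alpha> * A\<close> with \<open>A > 0\<close>, which is absurd because \<open>2 * \<alpha> < 1\<close>.  This excludes three fixed
  points (\<open>no_three_fixed_points\<close>) and also a fixed point next to a 2-cycle
  (\<open>fixed_point_excludes_2_cycle\<close>).

  Existence is by Picard iteration.  If \<open>T\<close> has neither fixed points nor 2-cycles, then any three
  consecutive points of an orbit are distinct, so the contraction applies to them.  Since the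
  relaxed triangle inequality bounds a two-step distance by \<open>s\<close> times the two single steps, the sum
  of two consecutive step lengths shrinks by the factor \<open>\<alpha> * s / (1 - \<alpha> * s) < 1\<close>
  (\<open>two_steps_contract\<close>).  Hence the orbit is injective and its steps decay geometrically.  In a
  \<open>b\<close>-metric space every geometric rate below \<open>1\<close> yields a Cauchy sequence, whatever the value of
  \<open>s\<close> (\<open>geometric_steps_Cauchy\<close>).  The limit \<open>l\<close> is then a fixed point: a \<open>b\<close>-metric need not be
  continuous, so one cannot pass to the limit inside \<open>d\<close>; instead the contraction at
  \<open>u n, l, u (n + 1)\<close> shows that \<open>u\<close> also converges to \<open>T l\<close>, and limits are unique
  (\<open>injective_orbit_limit_fixed\<close>).
\<close>

section \<open>Sequences in \<open>b\<close>-metric spaces\<close>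

context b_metric_space
begin

lemma self_zero: "x \<in> X \<Longrightarrow> d x x = 0"
  using zero_iff by blast

lemma pos: "x \<in> X \<Longrightarrow> y \<in> X \<Longrightarrow> x \<noteq> y \<Longrightarrow> 0 < d x y"
  using nonneg zero_iff by (metis less_eq_real_def)

lemma limit_unique:
  assumes "\<And>n. u n \<in> X" "k \<in> X" "l \<in> X" "b_converges d u k" "b_converges d u l"
  shows "k = l"
proof -
  have "(\<lambda>n. s * (d (u n) k + d (u n) l)) \<longlonglongrightarrow> s * (0 + 0)"
    using assms(4,5) unfolding b_converges_def by (intro tendsto_intros)
  moreover have "d k l \<le> s * (d (u n) k + d (u n) l)" for n
    using relaxed_triangle[of k "u n" l] commute[of k "u n"] assms(1-3) by simp
  ultimately have "d k l \<le> s * (0 + 0)"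
    by (intro LIMSEQ_le_const) auto
  then show ?thesis
    using nonneg[of k l] zero_iff[of k l] assms(2,3) by simp
qed

text \<open>For bounded index gaps, iterating the relaxed triangle inequality costs only a constant factor
  that depends on the bound.\<close>

lemma geometric_steps_bounded_gap:
  assumes u: "\<And>n. u n \<in> X" and C: "0 \<le> C" and g: "0 \<le> g" "g < 1"
    and step: "\<And>n. d (u n) (u (Suc n)) \<le> C * g ^ n"
  shows "\<exists>A\<ge>0. \<forall>k\<le>N. \<forall>n. d (u n) (u (n + k)) \<le> A * g ^ n"
proof (induction N)
  case 0
  show ?case
    by (intro exI[of _ 0]) (simp add: self_zero u)
next
  case (Suc N)
  then obtain A where A: "0 \<le> A" "\<And>k n. k \<le> N \<Longrightarrow> d (u n) (u (n + k)) \<le> A * g ^ n"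
    by blast
  have A'_nonneg: "0 \<le> s * (C + A)"
    using s_ge_1 C A(1) by simp
  have "d (u n) (u (n + k)) \<le> s * (C + A) * g ^ n" if k: "k \<le> Suc N" for k n
  proof (cases k)
    case 0
    then show ?thesis
      using A'_nonneg g(1) by (simp add: self_zero u)
  next
    case (Suc j)
    have "d (u n) (u (n + k)) \<le> s * (d (u n) (u (Suc n)) + d (u (Suc n)) (u (Suc n + j)))"
      using relaxed_triangle[of "u n" "u (Suc n)" "u (n + k)"] u Suc by simp
    also have "\<dots> \<le> s * (C * g ^ n + A * g ^ n)"
    proof -
      have "A * g ^ Suc n \<le> A * g ^ n"
        using A(1) g by (intro mult_left_mono power_decreasing) auto
      then have "d (u (Suc n)) (u (Suc n + j)) \<le> A * g ^ n"
        using A(2)[of j "Suc n"] k Suc by linarith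
      then show ?thesis
        using step[of n] s_ge_1 by (intro mult_left_mono add_mono) auto
    qed
    finally show ?thesis
      by (simp add: algebra_simps)
  qed
  with A'_nonneg show ?case by blast
qed

text \<open>Applying the relaxed triangle inequality step by step multiplies the \<open>j\<close>-th step by a factor
  of order \<open>s ^ j\<close>, which is summable only if \<open>s * g < 1\<close>.  Jumping \<open>N\<close> indices at a time,
  with \<open>N\<close> so large that \<open>s * g ^ N \<le> 1 / 2\<close>, turns the estimate into a self-improving one
  that holds for every \<open>g < 1\<close>.\<close>

lemma geometric_steps_uniform:
  assumes u: "\<And>n. u n \<in> X" and C: "0 \<le> C" and g: "0 \<le> g" "g < 1"
    and step: "\<And>n. d (u n) (u (Suc n)) \<le> C * g ^ n"
  shows "\<exists>M\<ge>0. \<forall>k n. d (u n) (u (n + k)) \<le> M * g ^ n"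
proof -
  have "(\<lambda>n. g ^ n) \<longlonglongrightarrow> 0"
    using g by (intro LIMSEQ_power_zero) auto
  moreover have "0 < 1 / (2 * s)"
    using s_ge_1 by simp
  ultimately have "\<forall>\<^sub>F n in sequentially. g ^ n < 1 / (2 * s)"
    by (rule order_tendstoD(2))
  then obtain N0 where N0: "\<And>n. N0 \<le> n \<Longrightarrow> g ^ n < 1 / (2 * s)"
    by (auto simp: eventually_sequentially)
  define N where "N = Suc N0"
  have N: "s * g ^ N \<le> 1 / 2" "0 < N"
    using N0[of N] s_ge_1 by (auto simp: N_def field_simps)
  obtain A where A: "0 \<le> A" "\<And>k n. k \<le> N \<Longrightarrow> d (u n) (u (n + k)) \<le> A * g ^ n"
    using geometric_steps_bounded_gap[of u C g N] assms by blast
  \<comment> \<open>\<open>M\<close> solves \<open>s * A + M / 2 = M\<close>.\<close>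
  define M where "M = 2 * s * A"
  have M: "0 \<le> M" "A \<le> M"
    using A(1) s_ge_1 mult_right_mono[of 1 "2 * s" A] by (auto simp: M_def)
  have "d (u n) (u (n + k)) \<le> M * g ^ n" for k n
  proof (induction k arbitrary: n rule: less_induct)
    case (less k)
    show ?case
    proof (cases "k \<le> N")
      case True
      then show ?thesis
        using A(2)[of k n] M(2) g(1) mult_right_mono[of A M "g ^ n"] by simp
    next
      case False
      have eq: "n + N + (k - N) = n + k"
        using False by simp
      have "d (u n) (u (n + k)) \<le> s * (d (u n) (u (n + N)) + d (u (n + N)) (u (n + k)))"
        using relaxed_triangle u by blast
      also have "\<dots> \<le> s * (A * g ^ n + M * g ^ (n + N))"
        using A(2)[of N n] less[of "k - N" "n + N"] False N(2) s_ge_1 eq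
        by (intro mult_left_mono add_mono) auto
      also have "\<dots> = M / 2 * g ^ n + M * g ^ n * (s * g ^ N)"
        by (simp add: M_def power_add algebra_simps)
      also have "\<dots> \<le> M / 2 * g ^ n + M * g ^ n * (1 / 2)"
        using N(1) M(1) g(1) by (intro add_left_mono mult_left_mono) auto
      finally show ?thesis
        by simp
    qed
  qed
  with M(1) show ?thesis by blast
qed

lemma geometric_steps_Cauchy:
  assumes u: "\<And>n. u n \<in> X" and "0 \<le> C" and g: "0 \<le> g" "g < 1"
    and "\<And>n. d (u n) (u (Suc n)) \<le> C * g ^ n"
  shows "b_Cauchy d u"
  unfolding b_Cauchy_def
proof (intro allI impI)
  fix e :: real
  assume e: "0 < e"
  obtain M where M: "0 \<le> M" "\<And>k n. d (u n) (u (n + k)) \<le> M * g ^ n"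
    using geometric_steps_uniform[of u C g] assms by blast
  have "(\<lambda>n. M * g ^ n) \<longlonglongrightarrow> M * 0"
    using g by (intro tendsto_intros LIMSEQ_power_zero) auto
  then have "\<forall>\<^sub>F n in sequentially. M * g ^ n < e"
    using e by (intro order_tendstoD(2)) auto
  then obtain N where N: "\<And>n. N \<le> n \<Longrightarrow> M * g ^ n < e"
    by (auto simp: eventually_sequentially)
  have ordered: "d (u n) (u m) < e" if "N \<le> n" "n \<le> m" for n m
    using M(2)[of n "m - n"] N[of n] that by simp
  have "\<bar>d (u n) (u m)\<bar> < e" if "N \<le> n" "N \<le> m" for n m
    using ordered[of n m] ordered[of m n] that commute[of "u n" "u m"] nonneg[of "u n" "u m"] u
    by (cases "n \<le> m") auto
  then show "\<exists>N. \<forall>n\<ge>N. \<forall>m\<ge>N. \<bar>d (u n) (u m)\<bar> < e"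
    by blast
qed

end

section \<open>Paired-Chatterjea contractions\<close>

locale paired_Chatterjea_map = b_metric_space X d s
  for X :: "'a set" and d :: "'a \<Rightarrow> 'a \<Rightarrow> real" and s :: real +
  fixes T :: "'a \<Rightarrow> 'a" and \<alpha> :: real
  assumes maps: "x \<in> X \<Longrightarrow> T x \<in> X"
    and alpha_nonneg: "0 \<le> \<alpha>"
    and alpha_less: "\<alpha> < 1 / (2 * s)"
    and contraction: "\<lbrakk>x \<in> X; y \<in> X; z \<in> X; x \<noteq> y; y \<noteq> z; x \<noteq> z\<rbrakk> \<Longrightarrow>
      d (T x) (T y) + d (T y) (T z) \<le> \<alpha> * (d x (T y) + d y (T x) + d y (T z) + d z (T y))"
begin

lemma alpha_s_less_half: "\<alpha> * s < 1 / 2"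
  using alpha_less s_ge_1 by (simp add: field_simps)

lemma alpha_less_half: "\<alpha> < 1 / 2"
  using alpha_s_less_half mult_left_mono[OF s_ge_1 alpha_nonneg] by simp

subsection \<open>Fixed points and 2-cycles\<close>

lemma no_three_fixed_points:
  assumes "x \<in> X" "y \<in> X" "z \<in> X" "x \<noteq> y" "y \<noteq> z" "x \<noteq> z"
    and "T x = x" "T y = y" "T z = z"
  shows False
proof -
  define A where "A = d x y + d y z"
  have "A \<le> \<alpha> * (2 * A)"
    using contraction[of x y z] assms commute[of x y] commute[of y z]
    by (simp add: A_def algebra_simps)
  moreover have "0 < A"
    using pos[of x y] pos[of y z] assms by (simp add: A_def)
  ultimately show False
    using alpha_less_half mult_strict_right_mono[of \<alpha> "1 / 2" "2 * A"] by simp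
qed

lemma fixed_points_le_two: "finite (fixed_points X T) \<and> card (fixed_points X T) \<le> 2"
proof (rule ccontr)
  assume "\<not> ?thesis"
  then have "infinite (fixed_points X T) \<or> 3 \<le> card (fixed_points X T)"
    by linarith
  then obtain F where "F \<subseteq> fixed_points X T" "card F = 3"
    by (meson infinite_arbitrarily_large obtain_subset_with_card_n)
  then obtain x y z where "x \<noteq> y" "y \<noteq> z" "x \<noteq> z"
    "x \<in> fixed_points X T" "y \<in> fixed_points X T" "z \<in> fixed_points X T"
    by (auto simp: card_3_iff)
  then show False
    using no_three_fixed_points[of x y z] by (auto simp: fixed_points_def)
qed

lemma fixed_point_excludes_2_cycle:
  assumes p: "p \<in> X" "T p = p" and y: "y \<in> X" "T (T y) = y" "T y \<noteq> y"
  shows False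
proof -
  define A where "A = d y p + d p (T y)"
  have Ty: "T y \<in> X"
    using y maps by simp
  have distinct: "y \<noteq> p" "p \<noteq> T y"
    using p y by auto
  have "A \<le> \<alpha> * (2 * A)"
    using contraction[of y p "T y"] distinct p y Ty commute[of p y] commute[of p "T y"]
    by (simp add: A_def algebra_simps)
  moreover have "0 < A"
    using pos[of y p] pos[of p "T y"] distinct p y Ty by (simp add: A_def)
  ultimately show False
    using alpha_less_half mult_strict_right_mono[of \<alpha> "1 / 2" "2 * A"] by simp
qed

subsection \<open>Picard orbits\<close>

text \<open>The images of three consecutive orbit points are again consecutive, so two of the four cross
  terms in the contraction vanish and the other two are two-step distances.\<close>

lemma two_steps_contract:
  assumes x: "x \<in> X" and ne: "x \<noteq> T x" "T x \<noteq> T (T x)" "x \<noteq> T (T x)"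
  shows "d (T x) (T (T x)) + d (T (T x)) (T (T (T x)))
    \<le> \<alpha> * s / (1 - \<alpha> * s) * (d x (T x) + d (T x) (T (T x)))"
proof -
  define a b c where "a = d x (T x)" and "b = d (T x) (T (T x))" and "c = d (T (T x)) (T (T (T x)))"
  have inX: "T x \<in> X" "T (T x) \<in> X" "T (T (T x)) \<in> X"
    using x maps by auto
  have "b + c \<le> \<alpha> * (d x (T (T x)) + d (T x) (T (T (T x))))"
    using contraction[of x "T x" "T (T x)"] x ne inX
    by (simp add: self_zero b_def c_def)
  also have "\<dots> \<le> \<alpha> * (s * (a + b) + s * (b + c))"
    unfolding a_def b_def c_def using x inX alpha_nonneg
    by (intro mult_left_mono add_mono relaxed_triangle) auto
  finally have "(b + c) * (1 - \<alpha> * s) \<le> \<alpha> * s * (a + b)"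
    by (simp add: algebra_simps)
  moreover have "0 < 1 - \<alpha> * s"
    using alpha_s_less_half by simp
  ultimately have "b + c \<le> \<alpha> * s * (a + b) / (1 - \<alpha> * s)"
    by (simp add: pos_le_divide_eq)
  then show ?thesis
    by (simp add: a_def b_def c_def)
qed

text \<open>Injectivity of the orbit guarantees that \<open>u n\<close>, \<open>l\<close> and \<open>u (n + 1)\<close> are distinct
  for all large \<open>n\<close>.\<close>

lemma injective_orbit_limit_fixed:
  assumes u: "\<And>n. u n \<in> X" and orbit: "\<And>n. u (Suc n) = T (u n)" and "inj u"
    and l: "l \<in> X" and conv: "b_converges d u l"
    and steps: "(\<lambda>n. d (u n) (u (Suc n))) \<longlonglongrightarrow> 0"
  shows "T l = l"
proof -
  have Tl: "T l \<in> X"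
    using l maps by simp
  obtain N where N: "\<And>n. N \<le> n \<Longrightarrow> u n \<noteq> l"
  proof (cases "\<exists>m. u m = l")
    case True
    then obtain m where "u m = l" by blast
    then have "u n \<noteq> l" if "Suc m \<le> n" for n
      using inj_eq[OF \<open>inj u\<close>, of n m] that by simp
    then show thesis by (rule that)
  qed (use that in blast)
  define p where "p n = d (u n) (T l) + d (u (Suc n)) (T l)" for n
  define r where "r n = \<alpha> * s * (d (u n) (u (Suc n)) + d (u (Suc n)) (u (Suc (Suc n))))
    + \<alpha> * (d (u (Suc n)) l + d (u (Suc (Suc n))) l)" for n
  have key: "p (Suc n) * (1 - \<alpha> * s) \<le> r n" if n: "N \<le> n" for n
  proof -
    have ne: "u n \<noteq> l" "l \<noteq> u (Suc n)" "u n \<noteq> u (Suc n)"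
      using N[of n] N[of "Suc n"] n inj_eq[OF \<open>inj u\<close>, of n "Suc n"] by auto
    have "p (Suc n) \<le> \<alpha> * (p n + (d (u (Suc n)) l + d (u (Suc (Suc n))) l))"
      using contraction[of "u n" l "u (Suc n)"] ne u[of n] u[of "Suc n"] u[of "Suc (Suc n)"] l Tl
        commute[of "T l" "u (Suc (Suc n))"] commute[of l "u (Suc n)"]
        commute[of l "u (Suc (Suc n))"]
      by (simp add: p_def orbit[symmetric] algebra_simps)
    moreover have "p n \<le> s * (d (u n) (u (Suc n)) + d (u (Suc n)) (u (Suc (Suc n)))) + s * p (Suc n)"
      using relaxed_triangle[of "u n" "u (Suc n)" "T l"]
        relaxed_triangle[of "u (Suc n)" "u (Suc (Suc n))" "T l"] u Tl
      by (simp add: p_def algebra_simps)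
    from mult_left_mono[OF this alpha_nonneg]
    have "\<alpha> * p n \<le> \<alpha> * s * (d (u n) (u (Suc n)) + d (u (Suc n)) (u (Suc (Suc n))))
        + \<alpha> * s * p (Suc n)"
      by (simp add: algebra_simps)
    ultimately show ?thesis
      by (simp add: r_def algebra_simps)
  qed
  have conv': "(\<lambda>n. d (u n) l) \<longlonglongrightarrow> 0"
    using conv by (simp add: b_converges_def)
  have "r \<longlonglongrightarrow> \<alpha> * s * (0 + 0) + \<alpha> * (0 + 0)"
    unfolding r_def
    by (intro tendsto_intros steps LIMSEQ_Suc[OF steps] LIMSEQ_Suc[OF conv']
        LIMSEQ_Suc[OF LIMSEQ_Suc[OF conv']])
  then have "(\<lambda>n. r n / (1 - \<alpha> * s)) \<longlonglongrightarrow> 0"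
    by (intro tendsto_divide_zero) simp
  moreover have "\<forall>\<^sub>F n in sequentially. d (u (Suc n)) (T l) \<le> r n / (1 - \<alpha> * s)"
  proof (rule eventually_sequentiallyI[of N])
    fix n
    assume "N \<le> n"
    then have "p (Suc n) \<le> r n / (1 - \<alpha> * s)"
      using key[of n] alpha_s_less_half by (simp add: pos_le_divide_eq)
    then show "d (u (Suc n)) (T l) \<le> r n / (1 - \<alpha> * s)"
      using nonneg[of "u (Suc (Suc n))" "T l"] u Tl by (simp add: p_def)
  qed
  moreover have "\<forall>\<^sub>F n in sequentially. 0 \<le> d (u (Suc n)) (T l)"
    using nonneg u Tl by simp
  ultimately have "(\<lambda>n. d (u (Suc n)) (T l)) \<longlonglongrightarrow> 0"
    by (auto intro: real_tendsto_sandwich[OF _ _ tendsto_const])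
  then have "b_converges d u (T l)"
    unfolding b_converges_def by (rule LIMSEQ_imp_Suc)
  then show ?thesis
    using limit_unique[of u "T l" l] u l Tl conv by blast
qed

lemma fixed_point_exists:
  assumes complete: "b_complete X d" and no_cycle: "prime_period_2_points X T = {}"
  shows "fixed_points X T \<noteq> {}"
proof
  assume no_fixed: "fixed_points X T = {}"
  have ne1: "T x \<noteq> x" if "x \<in> X" for x
    using no_fixed that by (auto simp: fixed_points_def)
  have ne2: "T (T x) \<noteq> x" if "x \<in> X" for x
    using no_cycle ne1 that by (auto simp: prime_period_2_points_def)
  obtain x0 where x0: "x0 \<in> X"
    using nonempty by blast
  define u where "u n = (T ^^ n) x0" for n
  have orbit: "u (Suc n) = T (u n)" for n
    by (simp add: u_def)
  have u: "u n \<in> X" for n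
    by (induction n) (auto simp: orbit maps, simp add: u_def x0)
  define g where "g = \<alpha> * s / (1 - \<alpha> * s)"
  have g: "0 \<le> g" "g < 1"
    using alpha_s_less_half alpha_nonneg s_ge_1 by (auto simp: g_def)
  define P where "P n = d (u n) (u (Suc n)) + d (u (Suc n)) (u (Suc (Suc n)))" for n
  have P_pos: "0 < P n" for n
    using pos[of "u n" "u (Suc n)"] nonneg[of "u (Suc n)" "u (Suc (Suc n))"] ne1[of "u n"] u
    by (simp add: P_def orbit[symmetric] add_pos_nonneg)
  have P_step: "P (Suc n) \<le> g * P n" for n
    using two_steps_contract[of "u n"] ne1[of "u n"] ne1[of "u (Suc n)"] ne2[of "u n"] u[of n]
      u[of "Suc n"]
    by (simp add: P_def g_def orbit)
  have P_geometric: "P n \<le> P 0 * g ^ n" for n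
  proof (induction n)
    case (Suc n)
    then show ?case
      using P_step[of n] mult_left_mono[OF Suc g(1)] by (simp add: algebra_simps)
  qed simp
  have step_le_P: "d (u n) (u (Suc n)) \<le> P n" for n
    using nonneg[of "u (Suc n)" "u (Suc (Suc n))"] u by (simp add: P_def)
  have step_geometric: "d (u n) (u (Suc n)) \<le> P 0 * g ^ n" for n
    using step_le_P[of n] P_geometric[of n] by linarith
  \<comment> \<open>\<open>P n\<close> is a function of the point \<open>u n\<close> and decreases strictly, so the orbit cannot
    return to an earlier point.\<close>
  have "P (Suc n) < P n" for n
  proof -
    have "g * P n < 1 * P n"
      using g(2) P_pos[of n] by (rule mult_strict_right_mono)
    then show ?thesis
      using P_step[of n] by linarith
  qed
  then have P_decreasing: "P n < P m" if "m < n" for m n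
    using lift_Suc_mono_less[of "\<lambda>n. - P n" m n] that by simp
  have "P m = P n" if "u m = u n" for m n
    using that by (simp add: P_def orbit)
  then have inj: "inj u"
    using P_decreasing unfolding inj_def by (metis less_irrefl linorder_neqE_nat)
  have "b_Cauchy d u"
    using geometric_steps_Cauchy[of u "P 0" g] u P_pos[of 0] g step_geometric by simp
  then obtain l where l: "l \<in> X" "b_converges d u l"
    using complete u unfolding b_complete_def by blast
  have "(\<lambda>n. P 0 * g ^ n) \<longlonglongrightarrow> P 0 * 0"
    using g by (intro tendsto_intros LIMSEQ_power_zero) auto
  then have bound_to_0: "(\<lambda>n. P 0 * g ^ n) \<longlonglongrightarrow> 0"
    by simp
  have "(\<lambda>n. d (u n) (u (Suc n))) \<longlonglongrightarrow> 0"
  proof (rule real_tendsto_sandwich[OF _ _ tendsto_const bound_to_0])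
    show "\<forall>\<^sub>F n in sequentially. 0 \<le> d (u n) (u (Suc n))"
      using nonneg[OF u u] by simp
    show "\<forall>\<^sub>F n in sequentially. d (u n) (u (Suc n)) \<le> P 0 * g ^ n"
      by (rule always_eventually) (rule allI, rule step_geometric)
  qed
  then have "T l = l"
    using injective_orbit_limit_fixed[of u l] u orbit inj l by blast
  then show False
    using ne1 l(1) by blast
qed

end

theorem theorem3p4:
  fixes X :: "'a set" and d :: "'a \<Rightarrow> 'a \<Rightarrow> real" and s :: real and T :: "'a \<Rightarrow> 'a"
  assumes "b_metric_space X d s"
    and "b_complete X d"
    and "infinite X \<or> 3 \<le> card X"
    and "T \<in> X \<rightarrow> X"
    and "paired_Chatterjea X d s T"
  shows "(fixed_points X T \<noteq> {} \<longleftrightarrow> prime_period_2_points X T = {})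
    \<and> finite (fixed_points X T) \<and> card (fixed_points X T) \<le> 2"
proof -
  interpret b_metric_space X d s
    by (fact assms(1))
  obtain \<alpha> where \<alpha>: "0 \<le> \<alpha>" "\<alpha> < 1 / (2 * s)"
    and contr: "\<And>x y z. \<lbrakk>x \<in> X; y \<in> X; z \<in> X; x \<noteq> y; y \<noteq> z; x \<noteq> z\<rbrakk> \<Longrightarrow>
      d (T x) (T y) + d (T y) (T z) \<le> \<alpha> * (d x (T y) + d y (T x) + d y (T z) + d z (T y))"
    using assms(5) unfolding paired_Chatterjea_def by blast
  interpret paired_Chatterjea_map X d s T \<alpha>
    using assms(4) \<alpha> contr by unfold_locales auto
  have "prime_period_2_points X T = {}" if "fixed_points X T \<noteq> {}"
    using that fixed_point_excludes_2_cycle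
    by (auto simp: fixed_points_def prime_period_2_points_def)
  then show ?thesis
    using fixed_point_exists[OF assms(2)] fixed_points_le_two by blast
qed

end
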